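(* For $n \ge 1$, $$\dim_k\left(\frac{R}{I_W^{[\mathbf{n}]}}\right) = \sum_{r=1}^{n} r!\, s(n,r),$$ where $s(n,r)$ is the signless Stirling number of the first kind.
   Context: $k$ is a field, $R = k[x_1,\ldots,x_n]$, $\mathfrak{S}_n$ the permutations of $[n]$ in one-line notation. $\sigma$ avoids a pattern $\tau\in\mathfrak{S}_r$ if no subsequence of $\sigma(1)\cdots\sigma(n)$ has the same relative order as $\tau$. $W = \mathfrak{S}_n(132,312)$ is the set of permutations avoiding $132$ and $312$, and $I_W = \langle \prod_{i=1}^n x_i^{\sigma(i)} : \sigma \in W\rangle$ (the hypercubic ideal). For $\mathbf{a}\in\mathbb{N}^n$ and a monomial ideal $I$ whose minimal generators divide $\mathbf{x}^{\mathbf{a}}$, the Alexander dual is $I^{[\mathbf{a}]} = \bigcap_{\mathbf{x}^{\mathbf{b}}} \mathfrak{m}^{\mathbf{a}\setminus\mathbf{b}}$ over minimal generators $\mathbf{x}^{\mathbf{b}}$ of $I$, with $(\mathbf{a}\setminus\mathbf{b})_i = a_i+1-b_i$ if $b_i\ge1$, $0$ if $b_i=0$, and $\mathfrak{m}^{\mathbf{d}} = \langle x_i^{d_i} : d_i\ge 1\rangle$. $\mathbf{n} = (n,\ldots,n)$. $s(n,r)$ is the number of permutations of $[n]$ with exactly $r$ cycles. *)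

theory Defs
  imports
    "HOL-Library.Poly_Mapping"
    "HOL-Algebra.Embedded_Algebras"
    "HOL-Algebra.QuotRing"
    "HOL-Combinatorics.Stirling"
    "HOL-Combinatorics.Orbits"
begin

subsection \<open>The polynomial ring in \<open>n\<close> variables\<close>

text \<open>
  A polynomial is a finitely supported map from exponent vectors to coefficients. The exponent
  vectors are indexed by all naturals; the ring in the variables \<open>x\<^sub>1, \<dots>, x\<^sub>n\<close> is cut out by its
  carrier.
\<close>

type_synonym 'k mpoly = "(nat \<Rightarrow>\<^sub>0 nat) \<Rightarrow>\<^sub>0 'k"

definition exponents :: "nat \<Rightarrow> (nat \<Rightarrow>\<^sub>0 nat) set" where
  "exponents n = {b. Poly_Mapping.keys b \<subseteq> {1..n}}"

definition mpoly_ring :: "nat \<Rightarrow> 'k::field mpoly ring" where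
  "mpoly_ring n =
    \<lparr>carrier = {p. Poly_Mapping.keys p \<subseteq> exponents n},
     monoid.mult = (\<lambda>p q. p * q), one = 1, ring.zero = 0, add = (\<lambda>p q. p + q)\<rparr>"

definition mconst :: "'k \<Rightarrow> 'k::field mpoly" where
  "mconst c = Poly_Mapping.single 0 c"

definition var :: "nat \<Rightarrow> 'k::field mpoly" where
  "var i = Poly_Mapping.single (Poly_Mapping.single i 1) 1"

definition monomial :: "(nat \<Rightarrow>\<^sub>0 nat) \<Rightarrow> 'k::field mpoly" where
  "monomial b = Poly_Mapping.single b 1"

lemma monomial_eq_prod_var:
  assumes "b \<in> exponents n"
  shows "(monomial b :: 'k::field mpoly) = (\<Prod>i = 1..n. var i ^ Poly_Mapping.lookup b i)"
proof -
  have pow: "(var i ^ e :: 'k mpoly) = monomial (Poly_Mapping.single i e)" for i e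
    by (induction e) (simp_all add: var_def monomial_def mult_single flip: single_add)
  have "(\<Prod>i\<in>A. monomial (f i) :: 'k mpoly) = monomial (\<Sum>i\<in>A. f i)" if "finite A"
    for A :: "nat set" and f :: "nat \<Rightarrow> (nat \<Rightarrow>\<^sub>0 nat)"
    using that by induction (simp_all add: monomial_def mult_single)
  moreover have "b = (\<Sum>i = 1..n. Poly_Mapping.single i (Poly_Mapping.lookup b i))"
  proof (rule poly_mapping_eqI)
    fix j
    show "Poly_Mapping.lookup b j =
      Poly_Mapping.lookup (\<Sum>i = 1..n. Poly_Mapping.single i (Poly_Mapping.lookup b i)) j"
      using assms by (auto simp: lookup_sum lookup_single when_def exponents_def in_keys_iff)
  qed
  ultimately show ?thesis
    by (simp add: pow)
qed

lemma exponents_add: "b \<in> exponents n \<Longrightarrow> c \<in> exponents n \<Longrightarrow> b + c \<in> exponents n"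
  unfolding exponents_def using Poly_Mapping.keys_add[of b c] by auto

lemma cring_mpoly_ring: "cring (mpoly_ring n :: 'k::field mpoly ring)"
proof -
  have uminus: "\<exists>q. Poly_Mapping.keys q \<subseteq> exponents n \<and> p + q = 0"
    if "Poly_Mapping.keys p \<subseteq> exponents n" for p :: "'k mpoly"
    using that by (intro exI[of _ "- p"]) simp
  have add: "Poly_Mapping.keys (p + q) \<subseteq> exponents n"
    if "Poly_Mapping.keys p \<subseteq> exponents n" "Poly_Mapping.keys q \<subseteq> exponents n"
    for p q :: "'k mpoly"
    using that Poly_Mapping.keys_add[of p q] by blast
  have mult: "Poly_Mapping.keys (p * q) \<subseteq> exponents n"
    if "Poly_Mapping.keys p \<subseteq> exponents n" "Poly_Mapping.keys q \<subseteq> exponents n"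
    for p q :: "'k mpoly"
    using that keys_mult[of p q] exponents_add by blast
  have one: "Poly_Mapping.keys (1 :: 'k mpoly) \<subseteq> exponents n"
    by (simp add: exponents_def flip: single_one)
  show ?thesis
  proof (rule cringI)
    show "abelian_group (mpoly_ring n :: 'k mpoly ring)"
      by (rule abelian_groupI) (use add uminus in \<open>simp_all add: mpoly_ring_def add.assoc add.commute\<close>)
    show "Group.comm_monoid (mpoly_ring n :: 'k mpoly ring)"
      by (rule comm_monoidI) (use mult one in \<open>auto simp: mpoly_ring_def mult.assoc mult.commute\<close>)
  qed (simp add: mpoly_ring_def distrib_right)
qed


subsection \<open>Monomial ideals and Alexander duality\<close>

definition min_gens :: "nat \<Rightarrow> 'k::field mpoly set \<Rightarrow> (nat \<Rightarrow>\<^sub>0 nat) set" where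
  "min_gens n I =
    (THE G. G \<subseteq> exponents n \<and> Idl\<^bsub>mpoly_ring n\<^esub> (monomial ` G) = I \<and>
            (\<forall>H. H \<subset> G \<longrightarrow> Idl\<^bsub>mpoly_ring n\<^esub> (monomial ` H) \<noteq> I))"

definition power_ideal :: "nat \<Rightarrow> (nat \<Rightarrow> nat) \<Rightarrow> 'k::field mpoly set" where
  "power_ideal n d = Idl\<^bsub>mpoly_ring n\<^esub> {var i ^ d i | i. i \<in> {1..n} \<and> d i \<ge> 1}"

text \<open>
  When \<open>\<^bold>x\<^sup>b\<close> divides \<open>\<^bold>x\<^sup>a\<close>, the subtraction below does not truncate.
\<close>

definition complement_exponent :: "(nat \<Rightarrow> nat) \<Rightarrow> (nat \<Rightarrow>\<^sub>0 nat) \<Rightarrow> nat \<Rightarrow> nat" where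
  "complement_exponent a b i =
    (if Poly_Mapping.lookup b i \<ge> 1 then a i + 1 - Poly_Mapping.lookup b i else 0)"

text \<open>
  The intersection with the carrier only matters for the zero ideal, which has no minimal generators.
\<close>

definition alexander_dual :: "nat \<Rightarrow> (nat \<Rightarrow> nat) \<Rightarrow> 'k::field mpoly set \<Rightarrow> 'k mpoly set" where
  "alexander_dual n a I =
    carrier (mpoly_ring n) \<inter> (\<Inter>b \<in> min_gens n I. power_ideal n (complement_exponent a b))"

text \<open>
  \<open>R / J\<close> has dimension \<open>d\<close> over \<open>k\<close>, where the scalars are embedded into \<open>R / J\<close> as the residue
  classes of the constant polynomials. In particular the dimension is finite.
\<close>

definition quotient_has_dim :: "nat \<Rightarrow> 'k::field mpoly set \<Rightarrow> nat \<Rightarrow> bool" where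
  "quotient_has_dim n J d \<longleftrightarrow>
    ring.dimension (mpoly_ring n Quot J) d
      (range (\<lambda>c. J +>\<^bsub>mpoly_ring n\<^esub> mconst c))
      (carrier (mpoly_ring n Quot J))"


subsection \<open>Pattern avoidance and the hypercubic ideal\<close>

text \<open>The pattern \<open>\<tau>\<close> is given in one-line notation, as a list.\<close>

definition avoids :: "nat \<Rightarrow> (nat \<Rightarrow> nat) \<Rightarrow> nat list \<Rightarrow> bool" where
  "avoids n \<sigma> \<tau> \<longleftrightarrow>
    \<not> (\<exists>f. strict_mono_on {..<length \<tau>} f \<and> f ` {..<length \<tau>} \<subseteq> {1..n} \<and>
          (\<forall>i<length \<tau>. \<forall>j<length \<tau>. \<sigma> (f i) < \<sigma> (f j) \<longleftrightarrow> \<tau> ! i < \<tau> ! j))"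

definition hypercubic_perms :: "nat \<Rightarrow> (nat \<Rightarrow> nat) set" where
  "hypercubic_perms n = {\<sigma>. \<sigma> permutes {1..n} \<and> avoids n \<sigma> [1, 3, 2] \<and> avoids n \<sigma> [3, 1, 2]}"

definition hypercubic_ideal :: "nat \<Rightarrow> 'k::field mpoly set" where
  "hypercubic_ideal n =
    Idl\<^bsub>mpoly_ring n\<^esub> ((\<lambda>\<sigma>. \<Prod>i = 1..n. var i ^ \<sigma> i) ` hypercubic_perms n)"


subsection \<open>The library's Stirling numbers count permutations by cycles\<close>

lemma orbit_transpose_comp:
  assumes q: "q permutes A" and a: "a \<notin> A" and b: "b \<in> A" and x: "x \<in> A" and fin: "finite A"
  defines "s \<equiv> Transposition.transpose a b \<circ> q"
  shows "orbit s x = (if b \<in> orbit q x then insert a (orbit q x) else orbit q x)" (is "_ = ?h")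
proof
  have qa: "q a = a" using q a by (simp add: permutes_not_in)
  have sa: "s a = b" by (simp add: s_def qa)
  have s1: "s y = (if q y = b then a else q y)" if "y \<in> A" for y
    using that q a by (auto simp: s_def transpose_def permutes_in_image)
  have perm: "permutation q" using q fin by (auto simp: permutation_permutes)
  have xq: "x \<in> orbit q x" using perm by (rule permutation_self_in_orbit)
  have sub: "y \<in> A" if "y \<in> orbit q x" for y
    using that by induction (use q x in \<open>simp_all add: permutes_in_image\<close>)
  have step: "s y \<in> ?h" if "y \<in> ?h" for y
  proof (cases "y = a")
    case True
    then show ?thesis using that sub a by (auto simp: sa split: if_splits)
  next
    case False
    then have "y \<in> orbit q x" using that by (auto split: if_splits)
    then show ?thesis using s1[OF sub] orbit.step[of y q x] by auto
  qed
  have xh: "x \<in> ?h" using xq by auto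
  show "orbit s x \<subseteq> ?h"
  proof
    fix y assume "y \<in> orbit s x"
    then show "y \<in> ?h" by induction (use step xh in blast)+
  qed
  have perms: "s permutes insert a A"
    unfolding s_def using q b
    by (intro permutes_compose permutes_swap_id) (auto intro: permutes_subset)
  then have "permutation s" using fin by (auto simp: permutation_permutes)
  then have xs: "x \<in> orbit s x" by (rule permutation_self_in_orbit)
  have qs: "q y \<in> orbit s x" if "y \<in> orbit s x" "y \<in> A" for y
  proof (cases "q y = b")
    case True
    then have "a \<in> orbit s x" using orbit.step[OF that(1)] s1[OF that(2)] by simp
    then show ?thesis using True orbit.step[of a s x] sa by simp
  next
    case False
    then show ?thesis using orbit.step[OF that(1)] s1[OF that(2)] by simp
  qed
  have inc: "orbit q x \<subseteq> orbit s x"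
  proof
    fix y assume "y \<in> orbit q x"
    then show "y \<in> orbit s x"
      by induction (use qs xs x sub in blast)+
  qed
  have "a \<in> orbit s x" if "b \<in> orbit q x"
  proof -
    have "\<exists>y \<in> orbit q x. b = q y"
      using that xq by cases auto
    then obtain y where y: "y \<in> orbit q x" "b = q y" by blast
    then have "s y = a" using s1[OF sub] by simp
    then show ?thesis using orbit.step[of y s x] y inc by auto
  qed
  then show "?h \<subseteq> orbit s x" using inc by auto
qed

lemma card_orbits_transpose_comp:
  assumes q: "q permutes A" and a: "a \<notin> A" and b: "b \<in> insert a A" and fin: "finite A"
  shows "card (orbit (Transposition.transpose a b \<circ> q) ` insert a A) =
    (if b = a then Suc (card (orbit q ` A)) else card (orbit q ` A))"
proof -
  have qa: "q a = a" using q a by (simp add: permutes_not_in)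
  have sub: "orbit q x \<subseteq> A" if "x \<in> A" for x
  proof
    fix y assume "y \<in> orbit q x"
    then show "y \<in> A"
      by induction (use q that in \<open>simp_all add: permutes_in_image\<close>)
  qed
  show ?thesis
  proof (cases "b = a")
    case True
    have "a \<in> orbit q a" using orbit.base[of q a] qa by simp
    then have "orbit q a \<notin> orbit q ` A" using sub a by blast
    then show ?thesis using True fin by simp
  next
    case False
    then have bA: "b \<in> A" using b by simp
    define s where "s = Transposition.transpose a b \<circ> q"
    define h where "h X = (if b \<in> X then insert a X else X)" for X :: "'a set"
    have sx: "orbit s x = h (orbit q x)" if "x \<in> A" for x
      unfolding s_def h_def by (rule orbit_transpose_comp[OF q a bA that fin])
    have sp: "s permutes insert a A"
      unfolding s_def using q bA
      by (intro permutes_compose permutes_swap_id) (auto intro: permutes_subset)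
    have "s a = b" by (simp add: s_def qa)
    then have "b \<in> orbit s a" using orbit.base[of s a] by simp
    then have "orbit s a = orbit s b"
      using orbit_cyclic_eq3[OF cyclic_on_orbit[OF sp]] fin by simp
    then have "orbit s ` insert a A = orbit s ` A" using bA by auto
    also have "\<dots> = h ` (orbit q ` A)" using sx by (auto simp: image_image)
    also have "card \<dots> = card (orbit q ` A)"
    proof (rule card_image, rule inj_onI)
      fix X Y assume "X \<in> orbit q ` A" "Y \<in> orbit q ` A" "h X = h Y"
      moreover from this have "a \<notin> X" "a \<notin> Y" using sub a by blast+
      ultimately show "X = Y" using False by (auto simp: h_def split: if_splits)
    qed
    finally show ?thesis using False by (simp add: s_def)
  qed
qed

lemma stirling_card_permutes:
  assumes "finite A"
  shows "stirling (card A) r = card {\<sigma>. \<sigma> permutes A \<and> card (orbit \<sigma> ` A) = r}"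
  using assms
proof (induction A arbitrary: r rule: finite_induct)
  case empty
  then show ?case by (cases r) (simp_all add: permutes_empty)
next
  case (insert a A)
  define S where "S r = {\<sigma>. \<sigma> permutes A \<and> card (orbit \<sigma> ` A) = r}" for r
  define F where "F = (\<lambda>(b, q). Transposition.transpose a b \<circ> q :: 'a \<Rightarrow> 'a)"
  define D where "D = {(b, q). b \<in> insert a A \<and> q permutes A}"
  have img: "{p. p permutes insert a A} = F ` D"
    unfolding F_def D_def permutes_insert by auto
  have inj: "inj_on F D"
  proof (rule inj_onI)
    fix d d' assume "d \<in> D" "d' \<in> D" "F d = F d'"
    moreover obtain b q c q' where dd: "d = (b, q)" "d' = (c, q')" by (cases d, cases d')
    ultimately have *: "(b, q) \<in> D" "(c, q') \<in> D" "F (b, q) = F (c, q')" by auto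
    then have "q a = a" "q' a = a" using insert.hyps by (auto simp: D_def permutes_not_in)
    moreover have "F (b, q) a = F (c, q') a" using * by simp
    ultimately have "b = c" by (simp add: F_def)
    moreover have "transpose a b \<circ> (transpose a b \<circ> q) = transpose a b \<circ> (transpose a b \<circ> q')"
      using * \<open>b = c\<close> by (simp add: F_def)
    then have "q = q'" by (simp add: o_assoc)
    ultimately show "d = d'" by (simp add: dd)
  qed
  have finS: "finite (S r)" for r
    using finite_permutations[OF insert.hyps(1)] by (auto simp: S_def intro: finite_subset[rotated])
  have cardF: "card (orbit (F (b, q)) ` insert a A) =
      (if b = a then Suc (card (orbit q ` A)) else card (orbit q ` A))" if "(b, q) \<in> D" for b q
    using card_orbits_transpose_comp[of q A a b] that insert.hyps by (simp add: F_def D_def)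
  have eq: "{\<sigma>. \<sigma> permutes insert a A \<and> card (orbit \<sigma> ` insert a A) = r} =
      F ` ({a} \<times> {q. q permutes A \<and> Suc (card (orbit q ` A)) = r} \<union> A \<times> S r)" (is "?L = F ` ?R")
  proof -
    have "?L = F ` {d \<in> D. card (orbit (F d) ` insert a A) = r}"
      using img by (auto simp: set_eq_iff image_iff)
    also have "{d \<in> D. card (orbit (F d) ` insert a A) = r} = ?R"
    proof (rule Set.set_eqI)
      fix d :: "'a \<times> ('a \<Rightarrow> 'a)"
      obtain b q where d: "d = (b, q)" by (cases d)
      have "(b, q) \<in> D \<and> card (orbit (F (b, q)) ` insert a A) = r \<longleftrightarrow> (b, q) \<in> ?R"
      proof (cases "(b, q) \<in> D")
        case True
        then show ?thesis
          by (subst cardF[OF True]) (use insert.hyps in \<open>auto simp: D_def S_def\<close>)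
      next
        case False
        then show ?thesis by (auto simp: D_def S_def)
      qed
      then show "d \<in> {d \<in> D. card (orbit (F d) ` insert a A) = r} \<longleftrightarrow> d \<in> ?R"
        by (simp only: d mem_Collect_eq)
    qed
    finally show ?thesis .
  qed
  have RD: "?R \<subseteq> D" using insert.hyps by (auto simp: D_def S_def)
  have fin1: "finite {q. q permutes A \<and> Suc (card (orbit q ` A)) = r}"
    using finite_permutations[OF insert.hyps(1)] by (auto intro: finite_subset[rotated])
  have "card {\<sigma>. \<sigma> permutes insert a A \<and> card (orbit \<sigma> ` insert a A) = r} = card ?R"
    unfolding eq by (rule card_image, rule inj_on_subset[OF inj RD])
  also have "\<dots> = card {q. q permutes A \<and> Suc (card (orbit q ` A)) = r} + card A * card (S r)"
    using insert.hyps finS fin1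
    by (subst card_Un_disjoint) (auto simp: card_cartesian_product)
  also have "\<dots> = stirling (card (insert a A)) r"
  proof (cases r)
    case 0
    then show ?thesis using insert.hyps insert.IH[of 0]
      by (cases "card A") (simp_all add: S_def)
  next
    case (Suc k)
    then show ?thesis using insert.hyps insert.IH[of k] insert.IH[of r] by (simp add: S_def)
  qed
  finally show ?case by simp
qed

end

(*
  A permutation lies in W exactly when every value is the maximum or the minimum of the values up to
  its position. Reversing the values preserves W, so the monomials outside the Alexander dual are the
  x^c for which some tau in W satisfies c_i < tau(i) for all i. Such a tau can be chosen greedily from
  the last position downwards: if the values still available are l+1, ..., l+m, then tau(m) = l+1 if
  c_m <= l, and tau(m) = l+m if l < c_m < l+m. Hence the number f(m,l) of admissible c satisfies
  f(m,l) = (l+1) f(m-1,l+1) + (m-1) f(m-1,l), a recurrence solved by the sum over r of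
  (l+1)(l+2)...(l+r) s(m,r).
*)

theory Submission
  imports Defs
begin

subsection \<open>Monomial ideals\<close>

text \<open>These are the exponents of the monomials in a monomial ideal. Divisibility is the
  pointwise order of the \<open>lookup\<close> functions, because the order on the type of exponent
  vectors itself is lexicographic.\<close>

definition multiples :: "nat \<Rightarrow> (nat \<Rightarrow>\<^sub>0 nat) set \<Rightarrow> (nat \<Rightarrow>\<^sub>0 nat) set" where
  "multiples n G = {b \<in> exponents n. \<exists>g\<in>G. Poly_Mapping.lookup g \<le> Poly_Mapping.lookup b}"

lemma multiples_add:
  assumes "b \<in> multiples n G" "c \<in> exponents n"
  shows "b + c \<in> multiples n G"
  using assms unfolding multiples_def
  by (auto simp: exponents_add le_fun_def lookup_add intro: trans_le_add1)

lemma ring_mpoly_ring: "ring (mpoly_ring n :: 'k::field mpoly ring)"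
  using cring_mpoly_ring by (rule cring.axioms)

lemma mpoly_ring_simps [simp]:
  "carrier (mpoly_ring n) = {p. Poly_Mapping.keys p \<subseteq> exponents n}"
  "monoid.mult (mpoly_ring n) = (*)" "one (mpoly_ring n) = 1"
  "ring.zero (mpoly_ring n) = 0" "add (mpoly_ring n) = (+)"
  by (simp_all add: mpoly_ring_def fun_eq_iff)

lemma a_inv_mpoly_ring:
  fixes p :: "'k::field mpoly"
  assumes "Poly_Mapping.keys p \<subseteq> exponents n"
  shows "\<ominus>\<^bsub>mpoly_ring n\<^esub> p = - p"
proof -
  interpret ring "mpoly_ring n :: 'k mpoly ring" by (rule ring_mpoly_ring)
  show ?thesis using assms by (intro minus_equality) auto
qed

text \<open>Every exponent of a product is a sum of exponents of the factors, and
  \<open>multiples n G\<close> absorbs addition of exponents, so a condition on the support alone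
  defines an ideal.\<close>

lemma ideal_multiples:
  "ideal {p :: 'k::field mpoly. Poly_Mapping.keys p \<subseteq> multiples n G} (mpoly_ring n)" (is "ideal ?J ?R")
proof (rule idealI[OF ring_mpoly_ring])
  interpret ring "mpoly_ring n :: 'k mpoly ring" by (rule ring_mpoly_ring)
  have sub: "multiples n G \<subseteq> exponents n" by (auto simp: multiples_def)
  show "subgroup ?J (add_monoid ?R)"
  proof (rule add.subgroupI)
    show "?J \<subseteq> carrier ?R" using sub by auto
    show "?J \<noteq> {}" by (auto intro: exI[of _ 0])
    show "\<ominus>\<^bsub>?R\<^esub> p \<in> ?J" if "p \<in> ?J" for p
      using that sub by (subst a_inv_mpoly_ring) auto
    show "p \<oplus>\<^bsub>?R\<^esub> q \<in> ?J" if "p \<in> ?J" "q \<in> ?J" for p q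
      using that Poly_Mapping.keys_add[of p q] by auto
  qed
  have mult: "p * q \<in> ?J" if "p \<in> ?J" "q \<in> carrier ?R" for p q
    using that keys_mult[of p q] by (fastforce intro: multiples_add)
  show "q \<otimes>\<^bsub>?R\<^esub> p \<in> ?J" if "p \<in> ?J" "q \<in> carrier ?R" for p q
    using mult[OF that] by (simp add: mult.commute)
  show "p \<otimes>\<^bsub>?R\<^esub> q \<in> ?J" if "p \<in> ?J" "q \<in> carrier ?R" for p q
    using mult[OF that] by simp
qed

lemma poly_mapping_eq_sum_single: "p = (\<Sum>b\<in>Poly_Mapping.keys p. Poly_Mapping.single b (Poly_Mapping.lookup p b))"
  by (rule poly_mapping_eqI) (auto simp: lookup_sum lookup_single when_def in_keys_iff)

text \<open>An ideal generated by monomials is spanned over the field by the monomials in it. From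
  here on ideals are handled as sets of exponents.\<close>

lemma genideal_monomials:
  fixes n :: nat
  assumes G: "G \<subseteq> exponents n"
  shows "Idl\<^bsub>mpoly_ring n\<^esub> (monomial ` G :: 'k::field mpoly set) =
    {p. Poly_Mapping.keys p \<subseteq> multiples n G}" (is "?I = ?J")
proof
  let ?R = "mpoly_ring n :: 'k mpoly ring"
  interpret ring ?R by (rule ring_mpoly_ring)
  have gens: "monomial ` G \<subseteq> carrier ?R" using G by (auto simp: monomial_def)
  show "?I \<subseteq> ?J"
    by (rule genideal_minimal[OF ideal_multiples])
      (use G in \<open>auto simp: monomial_def multiples_def\<close>)
  interpret I: ideal ?I ?R by (rule genideal_ideal[OF gens])
  have single: "Poly_Mapping.single b c \<in> ?I" if b: "b \<in> multiples n G" for b and c :: 'k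
  proof -
    obtain g where g: "g \<in> G" "Poly_Mapping.lookup g \<le> Poly_Mapping.lookup b"
      using b by (auto simp: multiples_def)
    \<comment> \<open>Subtraction of exponents truncates; divisibility of \<open>b\<close> by
      \<open>g\<close> makes it exact here.\<close>
    have "b = (b - g) + g"
      by (rule poly_mapping_eqI) (use g(2) in \<open>simp add: lookup_add lookup_minus le_fun_def\<close>)
    moreover have "b - g \<in> exponents n"
      using b by (auto simp: multiples_def exponents_def in_keys_iff lookup_minus subset_iff)
    then have "Poly_Mapping.single (b - g) c \<otimes>\<^bsub>?R\<^esub> monomial g \<in> ?I"
      using g(1) genideal_self[OF gens] by (intro I.I_l_closed) auto
    ultimately show ?thesis by (simp add: monomial_def mult_single)
  qed
  have sum: "(\<Sum>b\<in>A. f b) \<in> ?I" if "finite A" "\<And>b. b \<in> A \<Longrightarrow> f b \<in> ?I"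
    for A :: "(nat \<Rightarrow>\<^sub>0 nat) set" and f
    using that
  proof induction
    case empty
    then show ?case using I.zero_closed by simp
  next
    case (insert b A)
    then show ?case using I.a_closed[of "f b" "sum f A"] by simp
  qed
  show "?J \<subseteq> ?I"
  proof
    fix p :: "'k mpoly" assume "p \<in> ?J"
    then have "(\<Sum>b\<in>Poly_Mapping.keys p. Poly_Mapping.single b (Poly_Mapping.lookup p b)) \<in> ?I"
      by (intro sum single) auto
    then show "p \<in> ?I" by (simp flip: poly_mapping_eq_sum_single)
  qed
qed

text \<open>Each \<open>g\<close> in \<open>G\<close> is divisible by some \<open>h\<close> in
  \<open>H\<close>, which in turn is divisible by some \<open>g'\<close> in \<open>G\<close>. The
  antichain condition gives \<open>g' = g\<close>, so \<open>h\<close> is squeezed to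
  \<open>g\<close>.\<close>

lemma multiples_antichain:
  assumes anti: "\<forall>g\<in>G. \<forall>h\<in>G. Poly_Mapping.lookup g \<le> Poly_Mapping.lookup h \<longrightarrow> g = h"
    and H: "H \<subseteq> exponents n" and G: "G \<subseteq> exponents n"
    and eq: "multiples n H = multiples n G"
  shows "G \<subseteq> H"
proof
  fix g assume g: "g \<in> G"
  then have "g \<in> multiples n H" using G eq by (auto simp: multiples_def)
  then obtain h where h: "h \<in> H" "Poly_Mapping.lookup h \<le> Poly_Mapping.lookup g"
    by (auto simp: multiples_def)
  then have "h \<in> multiples n H" using H by (auto simp: multiples_def)
  then have "h \<in> multiples n G" using eq by simp
  then obtain g' where g': "g' \<in> G" "Poly_Mapping.lookup g' \<le> Poly_Mapping.lookup h"
    by (auto simp: multiples_def)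
  then have "g' = g" using anti g h(2) by (meson order_trans)
  then have "Poly_Mapping.lookup h = Poly_Mapping.lookup g" using g'(2) h(2) by simp
  then show "g \<in> H" using h(1) by (metis poly_mapping_eqI)
qed

text \<open>The exponent set can be read off from the ideal by testing which single monomials belong
  to it.\<close>

lemma genideal_monomials_eq_iff:
  assumes "G \<subseteq> exponents n" "H \<subseteq> exponents n"
  shows "Idl\<^bsub>mpoly_ring n\<^esub> (monomial ` G :: 'k::field mpoly set) = Idl\<^bsub>mpoly_ring n\<^esub> (monomial ` H)
    \<longleftrightarrow> multiples n G = multiples n H"
proof -
  have "X \<subseteq> Y" if "{p :: 'k mpoly. Poly_Mapping.keys p \<subseteq> X} = {p. Poly_Mapping.keys p \<subseteq> Y}"
    for X Y :: "(nat \<Rightarrow>\<^sub>0 nat) set"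
  proof
    fix b assume "b \<in> X"
    then have "monomial b \<in> {p :: 'k mpoly. Poly_Mapping.keys p \<subseteq> X}" by (simp add: monomial_def)
    then have "(monomial b :: 'k mpoly) \<in> {p. Poly_Mapping.keys p \<subseteq> Y}" using that by simp
    then show "b \<in> Y" by (simp add: monomial_def)
  qed
  then have "{p :: 'k mpoly. Poly_Mapping.keys p \<subseteq> X} = {p. Poly_Mapping.keys p \<subseteq> Y} \<longleftrightarrow> X = Y"
    for X Y :: "(nat \<Rightarrow>\<^sub>0 nat) set"
    by (metis subset_antisym)
  then show ?thesis by (simp only: genideal_monomials assms)
qed

text \<open>An antichain lies inside every monomial generating set of its ideal. Hence none of its
  proper subsets generates, and an irredundant generating set cannot properly contain it.\<close>

lemma min_gens_antichain:
  assumes G: "G \<subseteq> exponents n"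
    and anti: "\<forall>g\<in>G. \<forall>h\<in>G. Poly_Mapping.lookup g \<le> Poly_Mapping.lookup h \<longrightarrow> g = h"
  shows "min_gens n (Idl\<^bsub>mpoly_ring n\<^esub> (monomial ` G :: 'k::field mpoly set)) = G"
  unfolding min_gens_def
proof (rule the_equality, intro conjI allI impI)
  fix H assume HG: "H \<subset> G"
  then have H: "H \<subseteq> exponents n" using G by blast
  then show "Idl\<^bsub>mpoly_ring n\<^esub> (monomial ` H :: 'k mpoly set) \<noteq> Idl\<^bsub>mpoly_ring n\<^esub> (monomial ` G)"
    using multiples_antichain[OF anti H G] HG unfolding genideal_monomials_eq_iff[OF H G] by blast
next
  fix H
  assume H: "H \<subseteq> exponents n \<and>
    Idl\<^bsub>mpoly_ring n\<^esub> (monomial ` H :: 'k mpoly set) = Idl\<^bsub>mpoly_ring n\<^esub> (monomial ` G) \<and>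
    (\<forall>H'. H' \<subset> H \<longrightarrow>
      Idl\<^bsub>mpoly_ring n\<^esub> (monomial ` H' :: 'k mpoly set) \<noteq> Idl\<^bsub>mpoly_ring n\<^esub> (monomial ` G))"
  then have Hn: "H \<subseteq> exponents n"
    and "Idl\<^bsub>mpoly_ring n\<^esub> (monomial ` H :: 'k mpoly set) = Idl\<^bsub>mpoly_ring n\<^esub> (monomial ` G)"
    by blast+
  then have "multiples n H = multiples n G" unfolding genideal_monomials_eq_iff[OF Hn G] by blast
  then have "G \<subseteq> H" by (rule multiples_antichain[OF anti Hn G])
  then show "H = G" using H by blast
qed (use G in auto)

text \<open>The generators are powers of single variables, and such a power divides a monomial as
  soon as one coordinate is large enough. Membership is phrased exponent by exponent so that these
  ideals can be intersected.\<close>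

lemma power_ideal_eq:
  "(power_ideal n d :: 'k::field mpoly set) =
    {p. \<forall>b\<in>Poly_Mapping.keys p. b \<in> exponents n \<and> (\<exists>i\<in>{1..n}. 1 \<le> d i \<and> d i \<le> Poly_Mapping.lookup b i)}"
proof -
  define G where "G = (\<lambda>i. Poly_Mapping.single i (d i)) ` {i \<in> {1..n}. d i \<ge> 1}"
  have "(var i ^ e :: 'k mpoly) = monomial (Poly_Mapping.single i e)" for i e
    by (induction e) (simp_all add: var_def monomial_def mult_single flip: single_add)
  then have gens: "{var i ^ d i | i. i \<in> {1..n} \<and> d i \<ge> 1} = (monomial ` G :: 'k mpoly set)"
    by (auto simp: G_def)
  have G: "G \<subseteq> exponents n" by (auto simp: G_def exponents_def)
  have "Poly_Mapping.lookup (Poly_Mapping.single i e) \<le> Poly_Mapping.lookup b \<longleftrightarrow> e \<le> Poly_Mapping.lookup b i"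
    for i e and b :: "nat \<Rightarrow>\<^sub>0 nat"
    by (auto simp: le_fun_def lookup_single when_def)
  then have "multiples n G = {b \<in> exponents n. \<exists>i\<in>{1..n}. 1 \<le> d i \<and> d i \<le> Poly_Mapping.lookup b i}"
    by (auto simp: multiples_def G_def)
  then show ?thesis
    unfolding power_ideal_def gens genideal_monomials[OF G] by auto
qed


subsection \<open>The dimension of a quotient by a monomial ideal\<close>

text \<open>The classes of the standard monomials, those with exponent in \<open>S\<close>, form a
  basis. As \<open>dimension\<close> is an inductive predicate, the basis vectors are adjoined one
  at a time.\<close>

lemma quotient_has_dim_card:
  fixes J :: "'k::field mpoly set"
  assumes J: "ideal J (mpoly_ring n)"
    and J_eq: "J = {p. Poly_Mapping.keys p \<subseteq> exponents n - S}"
    and S: "S \<subseteq> exponents n" "finite S"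
  shows "quotient_has_dim n J (card S)"
proof -
  let ?R = "mpoly_ring n :: 'k mpoly ring"
  let ?Q = "?R Quot J"
  define cl where "cl p = J +>\<^bsub>?R\<^esub> p" for p
  define K where "K = range (\<lambda>c. cl (mconst c))"
  \<comment> \<open>The span of the classes of the monomials with exponent in
    \<open>T\<close>.\<close>
  define E where "E T = cl ` {p. Poly_Mapping.keys p \<subseteq> T}" for T
  interpret J: ideal J ?R by (rule J)
  interpret Q: ring ?Q by (rule J.quotient_is_ring)
  have hom: "cl \<in> ring_hom ?R ?Q" unfolding cl_def by (rule J.rcos_ring_hom)
  have cl_add: "cl p \<oplus>\<^bsub>?Q\<^esub> cl q = cl (p + q)"
    if "Poly_Mapping.keys p \<subseteq> exponents n" "Poly_Mapping.keys q \<subseteq> exponents n" for p q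
    using ring_hom_add[OF hom, of p q] that by simp
  have cl_mult: "cl p \<otimes>\<^bsub>?Q\<^esub> cl q = cl (p * q)"
    if "Poly_Mapping.keys p \<subseteq> exponents n" "Poly_Mapping.keys q \<subseteq> exponents n" for p q
    using ring_hom_mult[OF hom, of p q] that by simp
  have cl_closed: "cl p \<in> carrier ?Q" if "Poly_Mapping.keys p \<subseteq> exponents n" for p
    using ring_hom_closed[OF hom, of p] that by simp
  have cl_eqD: "p - q \<in> J" if "cl p = cl q" for p q
  proof -
    have "0 \<in> J" by (simp add: J_eq)
    then have "0 + p \<in> cl p" unfolding cl_def a_r_coset_def' mpoly_ring_simps by blast
    then have "p \<in> cl q" using that by simp
    then obtain h where "h \<in> J" "p = h + q" unfolding cl_def a_r_coset_def' mpoly_ring_simps by blast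
    then show ?thesis by simp
  qed
  have cl_J: "cl p = cl 0" if "p \<in> J" for p
    using J.a_rcos_const[of p] J.a_rcos_const[of 0] that by (simp add: cl_def J_eq)
  have zero: "\<zero>\<^bsub>?Q\<^esub> = cl 0"
    using J.a_rcos_const[of 0] by (simp add: FactRing_def cl_def J_eq)
  have const: "Poly_Mapping.keys (mconst c :: 'k mpoly) \<subseteq> exponents n" for c
    by (auto simp: mconst_def exponents_def)
  \<comment> \<open>A polynomial supported on \<open>insert b T\<close> is its \<open>b\<close>-term
    plus a polynomial supported on \<open>T\<close>, so the span grows by exactly the multiples of
    one class.\<close>
  have step: "Q.line_extension K (cl (monomial b)) (E T) = E (insert b T)"
    if "b \<in> exponents n" "b \<notin> T" "T \<subseteq> exponents n" for b T
  proof -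
    have mono: "Poly_Mapping.keys (monomial b :: 'k mpoly) \<subseteq> exponents n"
      using that by (simp add: monomial_def)
    have "Q.line_extension K (cl (monomial b)) (E T) =
        {cl (mconst c) \<otimes>\<^bsub>?Q\<^esub> cl (monomial b) \<oplus>\<^bsub>?Q\<^esub> cl p | c p. Poly_Mapping.keys p \<subseteq> T}"
      unfolding Q.line_extension_def set_add_def' r_coset_def K_def E_def by auto
    also have "\<dots> = {cl (Poly_Mapping.single b c + p) | c p. Poly_Mapping.keys p \<subseteq> T}"
    proof -
      have "cl (mconst c) \<otimes>\<^bsub>?Q\<^esub> cl (monomial b) \<oplus>\<^bsub>?Q\<^esub> cl p = cl (Poly_Mapping.single b c + p)"
        if "Poly_Mapping.keys p \<subseteq> T" for c p
      proof -
        have "cl (mconst c) \<otimes>\<^bsub>?Q\<^esub> cl (monomial b) = cl (Poly_Mapping.single b c)"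
          by (subst cl_mult[OF const mono]) (simp add: mconst_def monomial_def mult_single)
        then show ?thesis
          using that \<open>T \<subseteq> exponents n\<close> \<open>b \<in> exponents n\<close> by (subst cl_add[symmetric]) auto
      qed
      then show ?thesis by (intro Collect_cong ex_cong1 iffI; elim conjE; simp only: simp_thms)
    qed
    also have "\<dots> = E (insert b T)"
    proof
      show "{cl (Poly_Mapping.single b c + p) | c p. Poly_Mapping.keys p \<subseteq> T} \<subseteq> E (insert b T)"
      proof
        fix x assume "x \<in> {cl (Poly_Mapping.single b c + p) | c p. Poly_Mapping.keys p \<subseteq> T}"
        then obtain c p where x: "x = cl (Poly_Mapping.single b c + p)" "Poly_Mapping.keys p \<subseteq> T"
          by blast
        then have "Poly_Mapping.keys (Poly_Mapping.single b c + p) \<subseteq> insert b T"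
          using Poly_Mapping.keys_add[of "Poly_Mapping.single b c" p] by (auto split: if_splits)
        then show "x \<in> E (insert b T)" using x(1) by (auto simp: E_def)
      qed
      show "E (insert b T) \<subseteq> {cl (Poly_Mapping.single b c + p) | c p. Poly_Mapping.keys p \<subseteq> T}"
      proof
        fix x assume "x \<in> E (insert b T)"
        then obtain p where p: "x = cl p" "Poly_Mapping.keys p \<subseteq> insert b T" by (auto simp: E_def)
        define q where "q = p - Poly_Mapping.single b (Poly_Mapping.lookup p b)"
        have "Poly_Mapping.keys q \<subseteq> T"
          using p(2) by (auto simp: q_def in_keys_iff lookup_minus lookup_single when_def split: if_splits)
        moreover have "x = cl (Poly_Mapping.single b (Poly_Mapping.lookup p b) + q)"
          using p(1) by (simp add: q_def)
        ultimately show "x \<in> {cl (Poly_Mapping.single b c + p) | c p. Poly_Mapping.keys p \<subseteq> T}"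
          by blast
      qed
    qed
    finally show ?thesis .
  qed
  have "Q.dimension (card T) K (E T)" if "T \<subseteq> S" for T
    using finite_subset[OF that S(2)] that
  proof (induction T rule: finite_induct)
    case empty
    have "E {} = {\<zero>\<^bsub>?Q\<^esub>}" by (simp add: E_def zero)
    then show ?case by simp
  next
    case (insert b T)
    have b: "b \<in> exponents n" using insert.prems S by auto
    \<comment> \<open>Linear independence: a relation would put \<open>monomial b - p\<close> into
      \<open>J\<close>, although its support contains \<open>b\<close>, which lies in
      \<open>S\<close>.\<close>
    have "cl (monomial b) \<notin> E T"
    proof
      assume "cl (monomial b) \<in> E T"
      then obtain p where p: "Poly_Mapping.keys p \<subseteq> T" "cl (monomial b) = cl p" by (auto simp: E_def)
      have "Poly_Mapping.lookup p b = 0" using p(1) insert.hyps by (auto simp: in_keys_iff)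
      then have "b \<in> Poly_Mapping.keys (monomial b - p)"
        by (simp add: in_keys_iff lookup_minus monomial_def)
      moreover have "monomial b - p \<in> J" using cl_eqD[OF p(2)] .
      ultimately show False using insert.prems by (auto simp: J_eq)
    qed
    moreover have "cl (monomial b) \<in> carrier ?Q"
      using b by (intro cl_closed) (simp add: monomial_def)
    ultimately have "Q.dimension (Suc (card T)) K (Q.line_extension K (cl (monomial b)) (E T))"
      using insert by (intro Q.Suc_dim) auto
    then show ?case using insert b S by (subst (asm) step) auto
  qed
  from this[OF subset_refl] have "Q.dimension (card S) K (E S)" .
  moreover have "carrier ?Q = E S"
  proof
    show "E S \<subseteq> carrier ?Q" using cl_closed S by (auto simp: E_def)
    show "carrier ?Q \<subseteq> E S"
    proof
      fix x assume "x \<in> carrier ?Q"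
      then obtain p where p: "x = cl p" "Poly_Mapping.keys p \<subseteq> exponents n"
        by (auto simp: FactRing_def A_RCOSETS_def' cl_def)
      \<comment> \<open>Spanning: \<open>q\<close> keeps the terms of \<open>p\<close> with exponent
        in \<open>S\<close>, and the discarded terms form an element of \<open>J\<close>.\<close>
      define q where "q = (\<Sum>b\<in>Poly_Mapping.keys p \<inter> S. Poly_Mapping.single b (Poly_Mapping.lookup p b))"
      have lq: "Poly_Mapping.lookup q b = (if b \<in> S then Poly_Mapping.lookup p b else 0)" for b
        unfolding q_def by (auto simp: lookup_sum lookup_single when_def in_keys_iff)
      have q: "Poly_Mapping.keys q \<subseteq> S" by (auto simp: in_keys_iff lq split: if_splits)
      have r: "p - q \<in> J"
        using p(2) by (auto simp: J_eq in_keys_iff lq lookup_minus subset_iff split: if_splits)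
      have "cl p = cl (p - q) \<oplus>\<^bsub>?Q\<^esub> cl q"
        using r q S by (subst cl_add) (auto simp: J_eq)
      also have "\<dots> = cl q" using q S by (simp add: cl_J[OF r] cl_add)
      finally show "x \<in> E S" using p(1) q by (auto simp: E_def)
    qed
  qed
  ultimately show ?thesis by (simp add: quotient_has_dim_def K_def cl_def)
qed


subsection \<open>Permutations whose prefixes are intervals\<close>

text \<open>With \<open>i\<close> and \<open>j\<close> unordered, this says that each
  \<open>\<tau> k\<close> is the least or the greatest of the first \<open>k\<close> values.\<close>

definition no_middle :: "nat \<Rightarrow> (nat \<Rightarrow> nat) \<Rightarrow> bool" where
  "no_middle m \<tau> \<longleftrightarrow> (\<forall>i j k. 1 \<le> i \<and> i < k \<and> 1 \<le> j \<and> j < k \<and> k \<le> m \<longrightarrow> \<not> (\<tau> i < \<tau> k \<and> \<tau> k < \<tau> j))"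

text \<open>Of the nine comparisons in \<open>avoids\<close> the three diagonal ones are trivial.
  The other six are all listed, which leaves \<open>\<sigma>\<close> free to be any
  function.\<close>

lemma avoids_triple:
  "avoids n \<sigma> [x, y, z] \<longleftrightarrow>
    \<not> (\<exists>i j k. 1 \<le> i \<and> i < j \<and> j < k \<and> k \<le> n \<and>
      (\<sigma> i < \<sigma> j \<longleftrightarrow> x < y) \<and> (\<sigma> j < \<sigma> i \<longleftrightarrow> y < x) \<and> (\<sigma> i < \<sigma> k \<longleftrightarrow> x < z) \<and>
      (\<sigma> k < \<sigma> i \<longleftrightarrow> z < x) \<and> (\<sigma> j < \<sigma> k \<longleftrightarrow> y < z) \<and> (\<sigma> k < \<sigma> j \<longleftrightarrow> z < y))" (is "_ \<longleftrightarrow> \<not> ?P")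
proof -
  have three: "{..<length [x, y, z]} = {0, 1, 2}" by auto
  have all3: "(\<forall>i<length [x, y, z]. Q i) \<longleftrightarrow> Q 0 \<and> Q 1 \<and> Q 2" for Q
    by (auto simp: All_less_Suc numeral_2_eq_2)
  show ?thesis
  proof (intro iffI notI)
    assume "avoids n \<sigma> [x, y, z]" "?P"
    from this(2) obtain i j k where ijk: "1 \<le> i" "i < j" "j < k" "k \<le> n"
      "\<sigma> i < \<sigma> j \<longleftrightarrow> x < y" "\<sigma> j < \<sigma> i \<longleftrightarrow> y < x" "\<sigma> i < \<sigma> k \<longleftrightarrow> x < z"
      "\<sigma> k < \<sigma> i \<longleftrightarrow> z < x" "\<sigma> j < \<sigma> k \<longleftrightarrow> y < z" "\<sigma> k < \<sigma> j \<longleftrightarrow> z < y"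
      by (elim exE conjE) (rule that)
    define f where "f t = [i, j, k] ! t" for t
    have "strict_mono_on {0, 1, 2} f" using ijk(1-4) by (auto simp: strict_mono_on_def f_def)
    moreover have "f ` {0, 1, 2} \<subseteq> {1..n}" using ijk(1-4) by (auto simp: f_def)
    moreover have "\<forall>s<length [x, y, z]. \<forall>t<length [x, y, z].
        \<sigma> (f s) < \<sigma> (f t) \<longleftrightarrow> [x, y, z] ! s < [x, y, z] ! t"
      unfolding all3 by (simp add: f_def ijk(5-10))
    ultimately show False
      using \<open>avoids n \<sigma> [x, y, z]\<close> unfolding avoids_def three by blast
  next
    assume "\<not> ?P"
    show "avoids n \<sigma> [x, y, z]"
      unfolding avoids_def three
    proof (intro notI, elim exE conjE)
      fix f assume f: "strict_mono_on {0, 1, 2} f" "f ` {0, 1, 2} \<subseteq> {1..n}"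
        "\<forall>s<length [x, y, z]. \<forall>t<length [x, y, z].
          \<sigma> (f s) < \<sigma> (f t) \<longleftrightarrow> [x, y, z] ! s < [x, y, z] ! t"
      have "f 0 < f 1" "f 1 < f 2" using f(1) by (auto simp: strict_mono_on_def)
      moreover have "1 \<le> f 0" "f 2 \<le> n" using f(2) by auto
      ultimately have "?P"
        using f(3) unfolding all3 by (intro exI[of _ "f 0"] exI[of _ "f 1"] exI[of _ "f 2"]) simp
      then show False using \<open>\<not> ?P\<close> by contradiction
    qed
  qed
qed

text \<open>In 132 and in 312 the middle value stands last. The two patterns differ only in whether
  the smaller or the larger value comes first, which is the case distinction \<open>i < j\<close> or
  \<open>j < i\<close>.\<close>

lemma hypercubic_perms_eq: "hypercubic_perms n = {\<sigma>. \<sigma> permutes {1..n} \<and> no_middle n \<sigma>}"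
proof -
  have "avoids n \<sigma> [1, 3, 2] \<and> avoids n \<sigma> [3, 1, 2] \<longleftrightarrow> no_middle n \<sigma>" for \<sigma>
  proof
    assume L: "avoids n \<sigma> [1, 3, 2] \<and> avoids n \<sigma> [3, 1, 2]"
    show "no_middle n \<sigma>"
      unfolding no_middle_def
    proof (intro allI impI notI)
      fix i j k assume *: "1 \<le> i \<and> i < k \<and> 1 \<le> j \<and> j < k \<and> k \<le> n" "\<sigma> i < \<sigma> k \<and> \<sigma> k < \<sigma> j"
      then consider "i < j" | "j < i" by (metis less_asym linorder_neqE_nat)
      then show False
      proof cases
        case 1
        have "\<not> avoids n \<sigma> [1, 3, 2]"
          unfolding avoids_triple not_not
          by (rule exI[of _ i], rule exI[of _ j], rule exI[of _ k]) (use 1 * in auto)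
        then show ?thesis using L by simp
      next
        case 2
        have "\<not> avoids n \<sigma> [3, 1, 2]"
          unfolding avoids_triple not_not
          by (rule exI[of _ j], rule exI[of _ i], rule exI[of _ k]) (use 2 * in auto)
        then show ?thesis using L by simp
      qed
    qed
  next
    assume "no_middle n \<sigma>"
    then have nm: "\<not> (\<sigma> i < \<sigma> k \<and> \<sigma> k < \<sigma> j)" if "1 \<le> i" "i < k" "1 \<le> j" "j < k" "k \<le> n" for i j k
      using that by (auto simp: no_middle_def)
    show "avoids n \<sigma> [1, 3, 2] \<and> avoids n \<sigma> [3, 1, 2]"
      unfolding avoids_triple
    proof (intro conjI notI; elim exE conjE)
      fix i j k assume "1 \<le> i" "i < j" "j < k" "k \<le> n"
        "(\<sigma> i < \<sigma> k) = ((1::nat) < 2)" "(\<sigma> k < \<sigma> j) = ((2::nat) < 3)"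
      then show False using nm[of i k j] by simp
    next
      fix i j k assume "1 \<le> i" "i < j" "j < k" "k \<le> n"
        "(\<sigma> k < \<sigma> i) = ((2::nat) < 3)" "(\<sigma> j < \<sigma> k) = ((1::nat) < 2)"
      then show False using nm[of j k i] by simp
    qed
  qed
  then show ?thesis by (auto simp: hypercubic_perms_def)
qed

text \<open>Removing the last position takes away the least or the greatest value, so the recursion
  needs value sets that are shifted intervals.\<close>

definition dominated :: "nat \<Rightarrow> nat \<Rightarrow> (nat \<Rightarrow> nat) \<Rightarrow> bool" where
  "dominated m l c \<longleftrightarrow>
    (\<exists>\<tau>. bij_betw \<tau> {1..m} {l+1..l+m} \<and> no_middle m \<tau> \<and> (\<forall>i\<in>{1..m}. c i < \<tau> i))"

lemma dominated_antimono: "dominated m l c \<Longrightarrow> (\<And>i. c' i \<le> c i) \<Longrightarrow> dominated m l c'"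
  unfolding dominated_def by (meson le_less_trans)

text \<open>Adding 1 to all values keeps their relative order and relaxes the bounds. This makes it
  safe to spend the least value rather than the greatest on the last position.\<close>

lemma dominated_Suc_interval:
  assumes "dominated m l c"
  shows "dominated m (Suc l) c"
proof -
  obtain \<tau> where \<tau>: "bij_betw \<tau> {1..m} {l+1..l+m}" "no_middle m \<tau>" "\<forall>i\<in>{1..m}. c i < \<tau> i"
    using assms by (auto simp: dominated_def)
  have "bij_betw Suc {l+1..l+m} {Suc l+1..Suc l+m}" by (simp add: bij_betw_def)
  then have "bij_betw (Suc \<circ> \<tau>) {1..m} {Suc l+1..Suc l+m}" using \<tau>(1) bij_betw_trans by blast
  then show ?thesis
    unfolding dominated_def
    by (intro exI[of _ "Suc \<circ> \<tau>"]) (use \<tau> in \<open>auto simp: no_middle_def less_SucI\<close>)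
qed

text \<open>A value outside an interval is never strictly between two of its members, so
  \<open>v\<close> in the last position is not a middle value. It is applied with \<open>v\<close>
  directly below the interval or directly above it.\<close>

lemma dominated_extend:
  assumes "dominated m l' c" and v: "c (Suc m) < v" "v \<notin> {l'+1..l'+m}"
    and ins: "insert v {l'+1..l'+m} = {l+1..l+Suc m}"
  shows "dominated (Suc m) l c"
proof -
  obtain \<tau> where \<tau>: "bij_betw \<tau> {1..m} {l'+1..l'+m}" "no_middle m \<tau>" "\<forall>i\<in>{1..m}. c i < \<tau> i"
    using assms by (auto simp: dominated_def)
  define \<tau>' where "\<tau>' = \<tau>(Suc m := v)"
  have "bij_betw \<tau>' {1..m} {l'+1..l'+m}"
    using \<tau>(1) by (rule bij_betw_cong[THEN iffD1, rotated]) (simp add: \<tau>'_def)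
  then have "bij_betw \<tau>' ({1..m} \<union> {Suc m}) ({l'+1..l'+m} \<union> {v})"
    by (rule bij_betw_combine) (use v in \<open>auto simp: \<tau>'_def bij_betw_def\<close>)
  moreover have "{1..m} \<union> {Suc m} = {1..Suc m}" by auto
  ultimately have bij: "bij_betw \<tau>' {1..Suc m} {l+1..l+Suc m}" using ins by simp
  have "\<tau> i \<in> {l'+1..l'+m}" if "i \<in> {1..m}" for i using \<tau>(1) that by (auto simp: bij_betw_def)
  moreover have "v < l'+1 \<or> v > l'+m" using v by auto
  ultimately have ext: "\<not> (\<tau> i < v \<and> v < \<tau> j)" if "i \<in> {1..m}" "j \<in> {1..m}" for i j
    using that by fastforce
  have "no_middle (Suc m) \<tau>'"
    unfolding no_middle_def
  proof (intro allI impI)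
    fix i j k assume *: "1 \<le> i \<and> i < k \<and> 1 \<le> j \<and> j < k \<and> k \<le> Suc m"
    show "\<not> (\<tau>' i < \<tau>' k \<and> \<tau>' k < \<tau>' j)"
    proof (cases "k = Suc m")
      case True
      then show ?thesis using ext[of i j] * by (auto simp: \<tau>'_def)
    next
      case False
      then show ?thesis using \<tau>(2) * by (auto simp: \<tau>'_def no_middle_def)
    qed
  qed
  moreover have "\<forall>i\<in>{1..Suc m}. c i < \<tau>' i" using \<tau>(3) v by (auto simp: \<tau>'_def le_Suc_eq)
  ultimately show ?thesis using bij by (auto simp: dominated_def)
qed

text \<open>The greedy step: the last value must be extreme. If \<open>c (Suc m) \<le> l\<close>,
  the least value suffices and is the better choice; otherwise only the greatest value,
  \<open>l + Suc m\<close>, can exceed \<open>c (Suc m)\<close>.\<close>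

lemma dominated_Suc:
  "dominated (Suc m) l c \<longleftrightarrow>
    (if c (Suc m) \<le> l then dominated m (Suc l) c else c (Suc m) \<le> l + m \<and> dominated m l c)"
proof
  assume "dominated (Suc m) l c"
  then obtain \<tau> where \<tau>: "bij_betw \<tau> {1..Suc m} {l+1..l+Suc m}" "no_middle (Suc m) \<tau>"
    "\<forall>i\<in>{1..Suc m}. c i < \<tau> i"
    by (auto simp: dominated_def)
  let ?v = "\<tau> (Suc m)"
  have img: "\<tau> ` {1..Suc m} = {l+1..l+Suc m}" using \<tau>(1) by (simp add: bij_betw_def)
  have v: "?v \<in> {l+1..l+Suc m}" using imageI[of "Suc m" "{1..Suc m}" \<tau>] unfolding img by simp
  have "bij_betw \<tau> ({1..Suc m} - {Suc m}) ({l+1..l+Suc m} - {?v})"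
    by (rule bij_betw_DiffI[OF \<tau>(1)]) (use v in \<open>auto simp: bij_betw_def\<close>)
  moreover have "{1..Suc m} - {Suc m} = {1..m}" by auto
  ultimately have bij: "bij_betw \<tau> {1..m} ({l+1..l+Suc m} - {?v})" by simp
  have nm: "no_middle m \<tau>" using \<tau>(2) by (auto simp: no_middle_def)
  \<comment> \<open>Otherwise both extreme values occur at earlier positions, and the last value
    lies strictly between them.\<close>
  have "?v = l + 1 \<or> ?v = l + Suc m"
  proof (rule ccontr)
    assume "\<not> ?thesis"
    then have b: "l + 1 < ?v" "?v < l + Suc m" using v by auto
    have "l + 1 \<in> \<tau> ` {1..Suc m}" "l + Suc m \<in> \<tau> ` {1..Suc m}" unfolding img by auto
    then obtain i j where ij: "i \<in> {1..Suc m}" "\<tau> i = l + 1" "j \<in> {1..Suc m}" "\<tau> j = l + Suc m"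
      by (metis imageE)
    then have "i \<noteq> Suc m" "j \<noteq> Suc m" using b by auto
    then have "1 \<le> i \<and> i < Suc m \<and> 1 \<le> j \<and> j < Suc m \<and> Suc m \<le> Suc m" using ij by auto
    then have "\<not> (\<tau> i < ?v \<and> ?v < \<tau> j)" using \<tau>(2) unfolding no_middle_def by blast
    then show False using b ij by simp
  qed
  \<comment> \<open>For \<open>m = 0\<close> the two extremes coincide; that case is counted as the
    first.\<close>
  then consider "?v = l + 1" | "?v = l + Suc m" "m > 0" by fastforce
  then show "if c (Suc m) \<le> l then dominated m (Suc l) c else c (Suc m) \<le> l + m \<and> dominated m l c"
  proof cases
    case 1
    then have "{l+1..l+Suc m} - {?v} = {Suc l+1..Suc l+m}" by auto
    then have "dominated m (Suc l) c" using bij nm \<tau>(3) by (auto simp: dominated_def)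
    moreover have "c (Suc m) \<le> l" using 1 \<tau>(3) by (auto dest!: bspec[of _ _ "Suc m"])
    ultimately show ?thesis by simp
  next
    case 2
    then have "{l+1..l+Suc m} - {?v} = {l+1..l+m}" by auto
    then have "dominated m l c" using bij nm \<tau>(3) by (auto simp: dominated_def)
    moreover have "c (Suc m) \<le> l + m" using 2 \<tau>(3) by (auto dest!: bspec[of _ _ "Suc m"])
    \<comment> \<open>If \<open>c (Suc m) \<le> l\<close> although the greatest value was used, the
      shift of the remaining values supplies the claim for \<open>Suc l\<close>.\<close>
    ultimately show ?thesis using dominated_Suc_interval by auto
  qed
next
  assume R: "if c (Suc m) \<le> l then dominated m (Suc l) c else c (Suc m) \<le> l + m \<and> dominated m l c"
  show "dominated (Suc m) l c"
  proof (cases "c (Suc m) \<le> l")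
    case True
    then show ?thesis using R by (intro dominated_extend[of m "Suc l" c "l + 1" l]) auto
  next
    case False
    then show ?thesis using R by (intro dominated_extend[of m l c "l + Suc m" l]) auto
  qed
qed

lemma dominated_0: "dominated 0 l c"
  by (auto simp: dominated_def no_middle_def bij_betw_def)

lemma dominated_cong: "(\<And>i. i \<in> {1..m} \<Longrightarrow> c i = c' i) \<Longrightarrow> dominated m l c = dominated m l c'"
  by (auto simp: dominated_def)


subsection \<open>Counting dominated exponent vectors\<close>

definition dominated_exponents :: "nat \<Rightarrow> nat \<Rightarrow> (nat \<Rightarrow>\<^sub>0 nat) set" where
  "dominated_exponents m l = {b \<in> exponents m. dominated m l (Poly_Mapping.lookup b)}"

lemma dominated_exponents_0: "dominated_exponents 0 l = {0}"
  by (auto simp: dominated_exponents_def exponents_def dominated_0)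

text \<open>The exponent \<open>a\<close> of the last variable is split off. The two parts of the
  union are the two branches of the greedy step.\<close>

lemma dominated_exponents_Suc:
  "dominated_exponents (Suc m) l =
    (\<lambda>(a, b). b + Poly_Mapping.single (Suc m) a) `
      ({..l} \<times> dominated_exponents m (Suc l) \<union> {l+1..l+m} \<times> dominated_exponents m l)"
    (is "?L = ?F ` ?D")
proof (rule Set.set_eqI)
  fix b :: "nat \<Rightarrow>\<^sub>0 nat"
  define b' where "b' = b - Poly_Mapping.single (Suc m) (Poly_Mapping.lookup b (Suc m))"
  have lk: "Poly_Mapping.lookup b' i = (if i = Suc m then 0 else Poly_Mapping.lookup b i)" for i
    by (auto simp: b'_def lookup_minus lookup_single when_def)
  have b: "b = ?F (Poly_Mapping.lookup b (Suc m), b')"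
    by (rule poly_mapping_eqI) (auto simp: lookup_add lk lookup_single when_def)
  have ex: "b' \<in> exponents m" if "b \<in> exponents (Suc m)"
    using that by (auto simp: exponents_def in_keys_iff lk subset_iff le_Suc_eq split: if_splits)
  have dom: "dominated m k (Poly_Mapping.lookup b') \<longleftrightarrow> dominated m k (Poly_Mapping.lookup b)" for k
    by (rule dominated_cong) (auto simp: lk)
  show "b \<in> ?L \<longleftrightarrow> b \<in> ?F ` ?D"
  proof
    assume "b \<in> ?L"
    then have "(Poly_Mapping.lookup b (Suc m), b') \<in> ?D"
      using ex dom by (auto simp: dominated_exponents_def dominated_Suc split: if_splits)
    then show "b \<in> ?F ` ?D" using b by blast
  next
    assume "b \<in> ?F ` ?D"
    then obtain a d where ad: "b = d + Poly_Mapping.single (Suc m) a"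
      "a \<le> l \<and> d \<in> dominated_exponents m (Suc l) \<or> a \<in> {l+1..l+m} \<and> d \<in> dominated_exponents m l"
      by auto
    have d: "d \<in> exponents m" using ad(2) by (auto simp: dominated_exponents_def)
    then have "d \<in> exponents (Suc m)" by (auto simp: exponents_def)
    then have "b \<in> exponents (Suc m)" unfolding ad(1) by (rule exponents_add) (auto simp: exponents_def)
    moreover have "Suc m \<notin> Poly_Mapping.keys d" using d by (auto simp: exponents_def)
    then have "Poly_Mapping.lookup b (Suc m) = a" by (simp add: ad(1) lookup_add in_keys_iff)
    moreover have "dominated m k (Poly_Mapping.lookup b) \<longleftrightarrow> dominated m k (Poly_Mapping.lookup d)" for k
      by (rule dominated_cong) (auto simp: ad(1) lookup_add lookup_single when_def)
    ultimately have "b \<in> ?L \<longleftrightarrow>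
        (if a \<le> l then dominated m (Suc l) (Poly_Mapping.lookup d)
         else a \<le> l + m \<and> dominated m l (Poly_Mapping.lookup d))"
      by (simp only: dominated_exponents_def mem_Collect_eq dominated_Suc simp_thms)
    then show "b \<in> ?L" using ad(2) by (auto simp: dominated_exponents_def)
  qed
qed

lemma finite_dominated_exponents: "finite (dominated_exponents m l)"
  by (induction m arbitrary: l) (simp_all add: dominated_exponents_0 dominated_exponents_Suc)

text \<open>The split exponent is recovered as coordinate \<open>Suc m\<close>, which vanishes on
  the shorter vectors, so the decomposition is injective. The factors count \<open>{..l}\<close> and
  \<open>{l+1..l+m}\<close>.\<close>

lemma card_dominated_exponents_Suc:
  "card (dominated_exponents (Suc m) l) =
    Suc l * card (dominated_exponents m (Suc l)) + m * card (dominated_exponents m l)"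
proof -
  let ?D = "{..l} \<times> dominated_exponents m (Suc l) \<union> {l+1..l+m} \<times> dominated_exponents m l"
  have zero: "Poly_Mapping.lookup b (Suc m) = 0" if "b \<in> dominated_exponents m k" for b k
    using that by (auto simp: dominated_exponents_def exponents_def simp flip: not_in_keys_iff_lookup_eq_zero)
  have "inj_on (\<lambda>(a, b). b + Poly_Mapping.single (Suc m) a) ?D"
  proof (rule inj_onI, clarify)
    fix a b a' b'
    assume *: "(a, b) \<in> ?D" "(a', b') \<in> ?D"
      "b + Poly_Mapping.single (Suc m) a = b' + Poly_Mapping.single (Suc m) a'"
    then have "Poly_Mapping.lookup b (Suc m) = 0" "Poly_Mapping.lookup b' (Suc m) = 0"
      using zero by auto
    then have "a = a'" using arg_cong[OF *(3), of "\<lambda>x. Poly_Mapping.lookup x (Suc m)"]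
      by (simp add: lookup_add)
    then show "a = a' \<and> b = b'" using *(3) by simp
  qed
  then have "card (dominated_exponents (Suc m) l) = card ?D"
    unfolding dominated_exponents_Suc by (rule card_image)
  also have "\<dots> = Suc l * card (dominated_exponents m (Suc l)) + m * card (dominated_exponents m l)"
    by (subst card_Un_disjoint) (auto simp: finite_dominated_exponents card_cartesian_product)
  finally show ?thesis .
qed

text \<open>\<open>pochhammer (Suc l) r\<close> is the product (l+1)...(l+r). The recurrence for the
  cardinality matches that of the Stirling numbers.\<close>

lemma card_dominated_exponents:
  "card (dominated_exponents m l) = (\<Sum>r\<le>m. pochhammer (Suc l) r * stirling m r)"
proof (induction m arbitrary: l)
  case 0
  then show ?case by (simp add: dominated_exponents_0)
next
  case (Suc m)
  \<comment> \<open>The first factor is split off, not the last, because the recurrence passes from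
    \<open>l\<close> to \<open>Suc l\<close>.\<close>
  have poch: "pochhammer (Suc l) (Suc r) = Suc l * pochhammer (Suc (Suc l)) r" for r
    by (subst pochhammer_rec) simp
  have "(\<Sum>r\<le>Suc m. pochhammer (Suc l) r * stirling (Suc m) r) =
      (\<Sum>r\<le>m. pochhammer (Suc l) (Suc r) * stirling (Suc m) (Suc r))"
    by (subst sum.atMost_Suc_shift) simp
  also have "\<dots> = m * (\<Sum>r\<le>m. pochhammer (Suc l) (Suc r) * stirling m (Suc r)) +
      Suc l * (\<Sum>r\<le>m. pochhammer (Suc (Suc l)) r * stirling m r)"
    by (simp add: sum.distrib sum_distrib_left algebra_simps poch del: pochhammer_Suc)
  \<comment> \<open>For \<open>m > 0\<close> the index shift loses nothing: the terms with
    \<open>stirling m 0\<close> and \<open>stirling m (Suc m)\<close> both vanish. For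
    \<open>m = 0\<close> the outer factor is zero.\<close>
  also have "m * (\<Sum>r\<le>m. pochhammer (Suc l) (Suc r) * stirling m (Suc r)) =
      m * (\<Sum>r\<le>m. pochhammer (Suc l) r * stirling m r)"
  proof (cases m)
    case (Suc k)
    have "(\<Sum>r\<le>m. pochhammer (Suc l) (Suc r) * stirling m (Suc r)) =
        (\<Sum>r\<le>Suc m. pochhammer (Suc l) r * stirling m r)"
      by (subst sum.atMost_Suc_shift) (simp add: Suc)
    then show ?thesis by simp
  qed simp
  finally show ?case by (simp add: card_dominated_exponents_Suc Suc.IH)
qed


subsection \<open>The Alexander dual of the hypercubic ideal\<close>

definition perm_exponent :: "nat \<Rightarrow> (nat \<Rightarrow> nat) \<Rightarrow> (nat \<Rightarrow>\<^sub>0 nat)" where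
  "perm_exponent n \<sigma> = (\<Sum>i = 1..n. Poly_Mapping.single i (\<sigma> i))"

lemma lookup_perm_exponent:
  "Poly_Mapping.lookup (perm_exponent n \<sigma>) i = (if i \<in> {1..n} then \<sigma> i else 0)"
  by (auto simp: perm_exponent_def lookup_sum lookup_single when_def)

lemma perm_exponent_in_exponents: "perm_exponent n \<sigma> \<in> exponents n"
  by (auto simp: exponents_def in_keys_iff lookup_perm_exponent split: if_splits)

text \<open>Both vectors have coordinate sum 1 + ... + n, so a pointwise inequality between them is
  an equality.\<close>

lemma perm_exponent_antichain:
  assumes "\<sigma> permutes {1..n}" "\<tau> permutes {1..n}"
    and le: "Poly_Mapping.lookup (perm_exponent n \<sigma>) \<le> Poly_Mapping.lookup (perm_exponent n \<tau>)"
  shows "perm_exponent n \<sigma> = perm_exponent n \<tau>"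
proof -
  have le: "\<sigma> i \<le> \<tau> i" if "i \<in> {1..n}" for i
    using le_funD[OF le, of i] that by (simp add: lookup_perm_exponent)
  have "sum \<sigma> {1..n} = sum \<tau> {1..n}"
    using sum.permute[OF assms(1), of "\<lambda>x. x"] sum.permute[OF assms(2), of "\<lambda>x. x"] by (simp add: comp_def)
  then have "\<sigma> i = \<tau> i" if "i \<in> {1..n}" for i
    using sum_mono_inv[of \<sigma> "{1..n}" \<tau> i] le that by auto
  then show ?thesis by (intro poly_mapping_eqI) (simp add: lookup_perm_exponent)
qed

lemma min_gens_hypercubic_ideal:
  "min_gens n (hypercubic_ideal n :: 'k::field mpoly set) = perm_exponent n ` hypercubic_perms n"
proof -
  have "(\<Prod>i = 1..n. var i ^ \<sigma> i :: 'k mpoly) = monomial (perm_exponent n \<sigma>)" for \<sigma>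
    by (subst monomial_eq_prod_var[OF perm_exponent_in_exponents]) (simp add: lookup_perm_exponent)
  then have "(hypercubic_ideal n :: 'k mpoly set) =
      Idl\<^bsub>mpoly_ring n\<^esub> (monomial ` perm_exponent n ` hypercubic_perms n)"
    by (simp add: hypercubic_ideal_def image_image)
  then show ?thesis
  proof (simp only:, intro min_gens_antichain ballI impI)
    fix g h assume "g \<in> perm_exponent n ` hypercubic_perms n" "h \<in> perm_exponent n ` hypercubic_perms n"
      and le: "Poly_Mapping.lookup g \<le> Poly_Mapping.lookup h"
    then obtain \<sigma> \<tau> where "\<sigma> \<in> hypercubic_perms n" "\<tau> \<in> hypercubic_perms n"
      and gh: "g = perm_exponent n \<sigma>" "h = perm_exponent n \<tau>"
      by blast
    then have "\<sigma> permutes {1..n}" "\<tau> permutes {1..n}" by (simp_all add: hypercubic_perms_def)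
    then show "g = h" using le unfolding gh by (rule perm_exponent_antichain)
  qed (auto simp: perm_exponent_in_exponents)
qed

text \<open>Reversing values, \<open>v\<close> to \<open>Suc n - v\<close>, preserves the absence of
  middle values and turns \<open>c i < \<tau> i\<close> into
  \<open>c i + \<sigma> i \<le> n\<close>.\<close>

lemma dominated_iff_hypercubic:
  "dominated n 0 c \<longleftrightarrow> (\<exists>\<sigma>\<in>hypercubic_perms n. \<forall>i\<in>{1..n}. c i + \<sigma> i \<le> n)"
proof -
  have rev: "bij_betw (\<lambda>v. Suc n - v) {1..n} {1..n}"
    by (rule bij_betw_byWitness[where f' = "\<lambda>v. Suc n - v"]) auto
  \<comment> \<open>Even with truncated subtraction, a strict inequality after reversal comes from
    the opposite strict inequality before it.\<close>
  have nm: "no_middle n (\<lambda>i. Suc n - \<rho> i)" if "no_middle n \<rho>" for \<rho>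
    using that unfolding no_middle_def by (metis diff_less_mono2 diff_le_mono2 not_le)
  show ?thesis
  proof
    assume "dominated n 0 c"
    then obtain \<tau> where \<tau>: "bij_betw \<tau> {1..n} {1..n}" "no_middle n \<tau>" "\<forall>i\<in>{1..n}. c i < \<tau> i"
      by (auto simp: dominated_def)
    \<comment> \<open>Being the identity outside \<open>{1..n}\<close> is part of
      \<open>permutes\<close>.\<close>
    define \<sigma> where "\<sigma> i = (if i \<in> {1..n} then Suc n - \<tau> i else i)" for i
    have "bij_betw (\<lambda>i. Suc n - \<tau> i) {1..n} {1..n}"
      using bij_betw_trans[OF \<tau>(1) rev] by (simp add: comp_def)
    then have "bij_betw \<sigma> {1..n} {1..n}"
      by (rule bij_betw_cong[THEN iffD1, rotated]) (simp add: \<sigma>_def)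
    then have "\<sigma> permutes {1..n}" by (rule bij_imp_permutes) (auto simp: \<sigma>_def)
    moreover have "no_middle n \<sigma>" using nm[OF \<tau>(2)] by (auto simp: no_middle_def \<sigma>_def)
    moreover have "c i + \<sigma> i \<le> n" if "i \<in> {1..n}" for i
    proof -
      have "\<tau> i \<in> {1..n}" using \<tau>(1) that by (auto simp: bij_betw_def)
      moreover have "c i < \<tau> i" using \<tau>(3) that by blast
      ultimately show ?thesis using that by (simp add: \<sigma>_def)
    qed
    ultimately show "\<exists>\<sigma>\<in>hypercubic_perms n. \<forall>i\<in>{1..n}. c i + \<sigma> i \<le> n"
      by (auto simp: hypercubic_perms_eq)
  next
    assume "\<exists>\<sigma>\<in>hypercubic_perms n. \<forall>i\<in>{1..n}. c i + \<sigma> i \<le> n"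
    then obtain \<sigma> where \<sigma>: "\<sigma> permutes {1..n}" "no_middle n \<sigma>" "\<forall>i\<in>{1..n}. c i + \<sigma> i \<le> n"
      by (auto simp: hypercubic_perms_eq)
    have "bij_betw (\<lambda>i. Suc n - \<sigma> i) {1..n} {1..n}"
      using bij_betw_trans[OF permutes_imp_bij[OF \<sigma>(1)] rev] by (simp add: comp_def)
    moreover have "c i < Suc n - \<sigma> i" if "i \<in> {1..n}" for i
      using \<sigma>(3) that by fastforce
    ultimately show "dominated n 0 c"
      unfolding dominated_def by (intro exI[of _ "\<lambda>i. Suc n - \<sigma> i"]) (use nm[OF \<sigma>(2)] in simp)
  qed
qed

text \<open>A monomial lies outside the dual when, for some \<open>\<sigma>\<close> in W, all its
  exponents stay below n + 1 - \<open>\<sigma> i\<close>; after value reversal this is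
  domination.\<close>

lemma alexander_dual_hypercubic:
  "(alexander_dual n (\<lambda>_. n) (hypercubic_ideal n) :: 'k::field mpoly set) =
    {p. Poly_Mapping.keys p \<subseteq> exponents n - dominated_exponents n 0}"
proof -
  have "p \<in> power_ideal n (complement_exponent (\<lambda>_. n) (perm_exponent n \<sigma>)) \<longleftrightarrow>
      (\<forall>b\<in>Poly_Mapping.keys p. b \<in> exponents n \<and> \<not> (\<forall>i\<in>{1..n}. Poly_Mapping.lookup b i + \<sigma> i \<le> n))"
    if \<sigma>: "\<sigma> \<in> hypercubic_perms n" for \<sigma> and p :: "'k mpoly"
  proof -
    \<comment> \<open>All values lie between 1 and n, so every variable contributes the positive
      power n + 1 - \<open>\<sigma> i\<close>, without truncation.\<close>
    have "\<sigma> i \<in> {1..n}" if "i \<in> {1..n}" for i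
      using \<sigma> that permutes_in_image[of \<sigma> "{1..n}" i] by (simp add: hypercubic_perms_def)
    then have "1 \<le> complement_exponent (\<lambda>_. n) (perm_exponent n \<sigma>) i \<and>
        complement_exponent (\<lambda>_. n) (perm_exponent n \<sigma>) i \<le> x \<longleftrightarrow> \<not> x + \<sigma> i \<le> n"
      if "i \<in> {1..n}" for i x
      using that by (fastforce simp: complement_exponent_def lookup_perm_exponent)
    then show ?thesis unfolding power_ideal_eq by blast
  qed
  then show ?thesis
    unfolding alexander_dual_def min_gens_hypercubic_ideal
    by (fastforce simp: dominated_exponents_def dominated_iff_hypercubic)
qed


theorem theorem1:
  fixes n :: nat
  assumes "n \<ge> 1"
  shows "quotient_has_dim n
           (alexander_dual n (\<lambda>_. n) (hypercubic_ideal n :: 'k::field mpoly set))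
           (\<Sum>r = 1..n. fact r * stirling n r)"
proof -
  let ?S = "dominated_exponents n 0"
  have S: "?S \<subseteq> exponents n" by (auto simp: dominated_exponents_def)
  \<comment> \<open>Domination passes to divisors, so the complement of \<open>?S\<close> is closed
    under taking multiples, as an ideal requires.\<close>
  have "multiples n (exponents n - ?S) = exponents n - ?S"
  proof -
    have "b \<in> ?S" if "b' \<in> ?S" "b \<in> exponents n" "Poly_Mapping.lookup b \<le> Poly_Mapping.lookup b'" for b b'
      using that dominated_antimono[OF _ le_funD[OF that(3)]] by (simp add: dominated_exponents_def)
    then show ?thesis by (auto simp: multiples_def)
  qed
  then have "ideal (alexander_dual n (\<lambda>_. n) (hypercubic_ideal n :: 'k mpoly set)) (mpoly_ring n)"
    using ideal_multiples[of n "exponents n - ?S"] by (simp add: alexander_dual_hypercubic)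
  then have "quotient_has_dim n
      (alexander_dual n (\<lambda>_. n) (hypercubic_ideal n :: 'k mpoly set)) (card ?S)"
    using alexander_dual_hypercubic S finite_dominated_exponents by (rule quotient_has_dim_card)
  moreover have "card ?S = (\<Sum>r = 1..n. fact r * stirling n r)"
  proof -
    \<comment> \<open>At \<open>l = 0\<close> the rising factorial starts at 1 and is
      \<open>fact r\<close>.\<close>
    have "card ?S = (\<Sum>r\<le>n. fact r * stirling n r)"
      by (simp add: card_dominated_exponents pochhammer_fact)
    also have "\<dots> = (\<Sum>r = 1..n. fact r * stirling n r)"
    \<comment> \<open>The extra term \<open>r = 0\<close> vanishes since \<open>n \<ge> 1\<close>
      gives \<open>stirling n 0 = 0\<close>.\<close>
    proof (rule sum.mono_neutral_right)
      show "\<forall>r\<in>{..n} - {1..n}. fact r * stirling n r = 0"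
        using assms by (cases n) (auto simp: not_less_eq_eq)
    qed auto
    finally show ?thesis .
  qed
  ultimately show ?thesis by simp
qed

end
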